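(* Let $\Gamma\Rightarrow\Delta$ be a $\mathbf{PLK}$-provable sequent. Then there is a cut-free $\mathbf{PLK}$-proof of $\Gamma\Rightarrow\Delta$.
   Context: Formulas are built from a countably infinite set of propositional variables using the unary connective $\neg$ and the binary connectives $\land,\lor,\to$. A sequent is an expression $\Gamma\Rightarrow\Delta$ where $\Gamma,\Delta$ are finite ordered lists (possibly empty) of formulas. Commas denote concatenation of lists. The sequent system $\mathbf{PLK}$ has the following rules (premise(s) / conclusion), for all formulas $A,B$ and all lists $\Gamma,\Delta,\Pi,\Sigma$. Axioms: $p\Rightarrow p$ for $p$ a propositional variable. Weakening: WL: $\Gamma\Rightarrow\Delta$ / $A,\Gamma\Rightarrow\Delta$. WR: $\Gamma\Rightarrow\Delta$ / $\Gamma\Rightarrow\Delta,A$. Contraction: CL: $A,A,\Gamma\Rightarrow\Delta$ / $A,\Gamma\Rightarrow\Delta$. CR: $\Gamma\Rightarrow\Delta,A,A$ / $\Gamma\Rightarrow\Delta,A$. Exchange: EL: $\Gamma,A,B,\Pi\Rightarrow\Delta$ / $\Gamma,B,A,\Pi\Rightarrow\Delta$. ER: $\Gamma\Rightarrow\Delta,A,B,\Sigma$ / $\Gamma\Rightarrow\Delta,B,A,\Sigma$. Logical rules: $\neg$L: $\Gamma\Rightarrow\Delta,A$ / $\neg A,\Gamma\Rightarrow\Delta$. $\neg$R: $A,\Gamma\Rightarrow\Delta$ / $\Gamma\Rightarrow\Delta,\neg A$. $\land$L: $A,\Gamma\Rightarrow\Delta$ / $A\land B,\Gamma\Rightarrow\Delta$,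 and also $B,\Gamma\Rightarrow\Delta$ / $A\land B,\Gamma\Rightarrow\Delta$. $\land$R: $\Gamma\Rightarrow\Delta,A$ and $\Gamma\Rightarrow\Delta,B$ / $\Gamma\Rightarrow\Delta,A\land B$. $\lor$L: $A,\Gamma\Rightarrow\Delta$ and $B,\Gamma\Rightarrow\Delta$ / $A\lor B,\Gamma\Rightarrow\Delta$. $\lor$R: $\Gamma\Rightarrow\Delta,A$ / $\Gamma\Rightarrow\Delta,A\lor B$, and also $\Gamma\Rightarrow\Delta,B$ / $\Gamma\Rightarrow\Delta,A\lor B$. $\to$L: $\Gamma\Rightarrow\Delta,A$ and $B,\Gamma\Rightarrow\Delta$ / $A\to B,\Gamma\Rightarrow\Delta$. $\to$R: $A,\Gamma\Rightarrow\Delta,B$ / $\Gamma\Rightarrow\Delta,A\to B$. Cut: $\Gamma\Rightarrow\Delta,A$ and $A,\Gamma\Rightarrow\Delta$ / $\Gamma\Rightarrow\Delta$. A $\mathbf{PLK}$-proof of a sequent is a finite tree of sequents with axioms as leaves and the given sequent as root, in which every non-leaf node is the conclusion of an instance of a rule whose premises are its children. A sequent is $\mathbf{PLK}$-provable if it has a $\mathbf{PLK}$-proof. A proof is cut-free if it contains no application of the cut rule. *)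

theory Defs
  imports Main
begin

datatype form =
    Var nat
  | Neg form  ("\<^bold>\<not> _" [75] 75)
  | Conj form form  (infixr "\<^bold>\<and>" 70)
  | Disj form form  (infixr "\<^bold>\<or>" 69)
  | Impl form form  (infixr "\<^bold>\<rightarrow>" 68)

datatype sequent = Sequent "form list" "form list"  (infix "\<leadsto>" 55)

inductive axiom :: "sequent \<Rightarrow> bool" where
  Ax: "axiom ([Var p] \<leadsto> [Var p])"

text \<open>The inference relations take the list of premises, from left to right, and the conclusion.\<close>

inductive noncut_rule :: "sequent list \<Rightarrow> sequent \<Rightarrow> bool" where
  WL: "noncut_rule [\<Gamma> \<leadsto> \<Delta>] (A # \<Gamma> \<leadsto> \<Delta>)"
| WR: "noncut_rule [\<Gamma> \<leadsto> \<Delta>] (\<Gamma> \<leadsto> \<Delta> @ [A])"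
| CL: "noncut_rule [A # A # \<Gamma> \<leadsto> \<Delta>] (A # \<Gamma> \<leadsto> \<Delta>)"
| CR: "noncut_rule [\<Gamma> \<leadsto> \<Delta> @ [A, A]] (\<Gamma> \<leadsto> \<Delta> @ [A])"
| EL: "noncut_rule [\<Gamma> @ [A, B] @ \<Pi> \<leadsto> \<Delta>] (\<Gamma> @ [B, A] @ \<Pi> \<leadsto> \<Delta>)"
| ER: "noncut_rule [\<Gamma> \<leadsto> \<Delta> @ [A, B] @ \<Sigma>] (\<Gamma> \<leadsto> \<Delta> @ [B, A] @ \<Sigma>)"
| NegL: "noncut_rule [\<Gamma> \<leadsto> \<Delta> @ [A]] (\<^bold>\<not> A # \<Gamma> \<leadsto> \<Delta>)"
| NegR: "noncut_rule [A # \<Gamma> \<leadsto> \<Delta>] (\<Gamma> \<leadsto> \<Delta> @ [\<^bold>\<not> A])"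
| ConjL1: "noncut_rule [A # \<Gamma> \<leadsto> \<Delta>] ((A \<^bold>\<and> B) # \<Gamma> \<leadsto> \<Delta>)"
| ConjL2: "noncut_rule [B # \<Gamma> \<leadsto> \<Delta>] ((A \<^bold>\<and> B) # \<Gamma> \<leadsto> \<Delta>)"
| ConjR: "noncut_rule [\<Gamma> \<leadsto> \<Delta> @ [A], \<Gamma> \<leadsto> \<Delta> @ [B]] (\<Gamma> \<leadsto> \<Delta> @ [A \<^bold>\<and> B])"
| DisjL: "noncut_rule [A # \<Gamma> \<leadsto> \<Delta>, B # \<Gamma> \<leadsto> \<Delta>] ((A \<^bold>\<or> B) # \<Gamma> \<leadsto> \<Delta>)"
| DisjR1: "noncut_rule [\<Gamma> \<leadsto> \<Delta> @ [A]] (\<Gamma> \<leadsto> \<Delta> @ [A \<^bold>\<or> B])"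
| DisjR2: "noncut_rule [\<Gamma> \<leadsto> \<Delta> @ [B]] (\<Gamma> \<leadsto> \<Delta> @ [A \<^bold>\<or> B])"
| ImplL: "noncut_rule [\<Gamma> \<leadsto> \<Delta> @ [A], B # \<Gamma> \<leadsto> \<Delta>] ((A \<^bold>\<rightarrow> B) # \<Gamma> \<leadsto> \<Delta>)"
| ImplR: "noncut_rule [A # \<Gamma> \<leadsto> \<Delta> @ [B]] (\<Gamma> \<leadsto> \<Delta> @ [A \<^bold>\<rightarrow> B])"

inductive cut_rule :: "sequent list \<Rightarrow> sequent \<Rightarrow> bool" where
  Cut: "cut_rule [\<Gamma> \<leadsto> \<Delta> @ [A], A # \<Gamma> \<leadsto> \<Delta>] (\<Gamma> \<leadsto> \<Delta>)"

datatype sequent_tree = Node (root: sequent) (children: "sequent_tree list")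

fun PLK_correct :: "sequent_tree \<Rightarrow> bool" where
  "PLK_correct (Node S ts) \<longleftrightarrow>
     (if ts = [] then axiom S
      else noncut_rule (map root ts) S \<or> cut_rule (map root ts) S)
     \<and> (\<forall>t \<in> set ts. PLK_correct t)"

definition PLK_proof :: "sequent_tree \<Rightarrow> sequent \<Rightarrow> bool" where
  "PLK_proof t S \<longleftrightarrow> PLK_correct t \<and> root t = S"

definition PLK_provable :: "sequent \<Rightarrow> bool" where
  "PLK_provable S \<longleftrightarrow> (\<exists>t. PLK_proof t S)"

text \<open>Trees carry no rule labels. This creates no ambiguity: comparing the lengths of the lists
  shows that no instance of cut is an instance of another rule.\<close>

fun cut_free :: "sequent_tree \<Rightarrow> bool" where
  "cut_free (Node S ts) \<longleftrightarrow> \<not> cut_rule (map root ts) S \<and> (\<forall>t \<in> set ts. cut_free t)"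

end

theory Submission
  imports Defs
begin

text \<open>The proof is semantic. Every inference, cut included, preserves truth under all valuations,
  so a provable sequent is valid (\<open>provable_valid\<close>). Conversely every valid sequent has a
  cut-free proof (\<open>valid_cut_free_provable\<close>), and the two facts together eliminate cuts.

  The converse is a backward proof search, by induction on the total size of the formulas. For each
  connective and each side there is a rule whose premises are smaller than its conclusion and are
  valid whenever the conclusion is. For conjunction on the left and disjunction on the right this
  is not the given rule, which forgets one component, but the version keeping both components; it
  is derived by applying both given rules and contracting. Once only variables are left, validity
  forces some variable to occur on both sides, since otherwise the valuation making exactly the
  antecedent true is a countermodel; the sequent is then a weakening of an axiom.

  The structural rules act only at the ends of the lists or on neighbours. Their combined force is
  that provability is monotone in the sets of formulas occurring on each side
  (\<open>cut_free_provable_mono\<close>), which lets the search ignore order and multiplicity.\<close>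

section \<open>Validity and soundness\<close>

fun holds :: "(nat \<Rightarrow> bool) \<Rightarrow> form \<Rightarrow> bool" where
  "holds v (Var p) \<longleftrightarrow> v p"
| "holds v (\<^bold>\<not> A) \<longleftrightarrow> \<not> holds v A"
| "holds v (A \<^bold>\<and> B) \<longleftrightarrow> holds v A \<and> holds v B"
| "holds v (A \<^bold>\<or> B) \<longleftrightarrow> holds v A \<or> holds v B"
| "holds v (A \<^bold>\<rightarrow> B) \<longleftrightarrow> (holds v A \<longrightarrow> holds v B)"

fun valid :: "sequent \<Rightarrow> bool" where
  "valid (\<Gamma> \<leadsto> \<Delta>) \<longleftrightarrow> (\<forall>v. (\<forall>A \<in> set \<Gamma>. holds v A) \<longrightarrow> (\<exists>B \<in> set \<Delta>. holds v B))"

lemma noncut_rule_sound: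
  assumes "noncut_rule Ss S" "\<forall>S' \<in> set Ss. valid S'"
  shows "valid S"
  using assms by (induction rule: noncut_rule.induct) (simp; blast)+

lemma cut_rule_sound:
  assumes "cut_rule Ss S" "\<forall>S' \<in> set Ss. valid S'"
  shows "valid S"
  using assms by (induction rule: cut_rule.induct) (simp; blast)

lemma PLK_correct_valid: "PLK_correct t \<Longrightarrow> valid (root t)"
proof (induction t)
  case (Node S ts)
  show ?case
  proof (cases "ts = []")
    case True
    then show ?thesis using Node.prems by (auto elim: axiom.cases)
  next
    case False
    have "\<forall>S' \<in> set (map root ts). valid S'" using Node by auto
    then show ?thesis
      using Node.prems False noncut_rule_sound cut_rule_sound by auto
  qed
qed

lemma provable_valid: "PLK_provable S \<Longrightarrow> valid S"
  unfolding PLK_provable_def PLK_proof_def using PLK_correct_valid by blast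

section \<open>Cut-free provability\<close>

definition cut_free_provable :: "sequent \<Rightarrow> bool" where
  "cut_free_provable S \<longleftrightarrow> (\<exists>t. PLK_proof t S \<and> cut_free t)"

text \<open>The two premises of a cut have one formula more than its conclusion, on the right and on the
  left respectively, and no other rule with two premises has this shape.\<close>

lemma noncut_rule_not_cut_rule: "noncut_rule Ss S \<Longrightarrow> \<not> cut_rule Ss S"
  by (induction rule: noncut_rule.induct) (auto elim!: cut_rule.cases dest: arg_cong[of _ _ length])

lemma noncut_rule_premises_nonempty: "noncut_rule Ss S \<Longrightarrow> Ss \<noteq> []"
  by (induction rule: noncut_rule.induct) auto

lemma cut_free_provable_axiom: "cut_free_provable ([Var p] \<leadsto> [Var p])"
  unfolding cut_free_provable_def PLK_proof_def
  by (rule exI[of _ "Node ([Var p] \<leadsto> [Var p]) []"]) (auto intro: axiom.intros elim: cut_rule.cases)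

lemma cut_free_provable_rule:
  assumes rule: "noncut_rule Ss S" and "\<forall>S' \<in> set Ss. cut_free_provable S'"
  shows "cut_free_provable S"
proof -
  obtain f where f: "\<forall>S' \<in> set Ss. PLK_proof (f S') S' \<and> cut_free (f S')"
    using assms(2) unfolding cut_free_provable_def by metis
  have "map root (map f Ss) = Ss"
    using f by (auto simp: PLK_proof_def intro: map_idI)
  then have "PLK_proof (Node S (map f Ss)) S" "cut_free (Node S (map f Ss))"
    using f rule noncut_rule_not_cut_rule noncut_rule_premises_nonempty
    by (auto simp: PLK_proof_def)
  then show ?thesis unfolding cut_free_provable_def by blast
qed

lemma cut_free_provable_rule1:
  "noncut_rule [S1] S \<Longrightarrow> cut_free_provable S1 \<Longrightarrow> cut_free_provable S"
  by (rule cut_free_provable_rule) auto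

lemma cut_free_provable_rule2:
  "noncut_rule [S1, S2] S \<Longrightarrow> cut_free_provable S1 \<Longrightarrow> cut_free_provable S2 \<Longrightarrow> cut_free_provable S"
  by (rule cut_free_provable_rule) auto

section \<open>Admissible structural reasoning\<close>

lemma exchange_left:
  "cut_free_provable (\<Pi> @ A # B # \<Sigma> \<leadsto> \<Delta>) \<longleftrightarrow> cut_free_provable (\<Pi> @ B # A # \<Sigma> \<leadsto> \<Delta>)"
  using cut_free_provable_rule1[OF EL[of \<Pi> A B \<Sigma> \<Delta>]] cut_free_provable_rule1[OF EL[of \<Pi> B A \<Sigma> \<Delta>]]
  by auto

lemma exchange_right:
  "cut_free_provable (\<Gamma> \<leadsto> \<Pi> @ A # B # \<Sigma>) \<longleftrightarrow> cut_free_provable (\<Gamma> \<leadsto> \<Pi> @ B # A # \<Sigma>)"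
  using cut_free_provable_rule1[OF ER[of \<Gamma> \<Pi> A B \<Sigma>]] cut_free_provable_rule1[OF ER[of \<Gamma> \<Pi> B A \<Sigma>]]
  by auto

text \<open>Iterated exchange carries a formula over a whole block. The prefix \<open>\<Pi>\<close> is what the induction
  on the block needs: it absorbs the formulas already passed.\<close>

lemma move_left:
  "cut_free_provable (\<Pi> @ A # \<Theta> @ \<Sigma> \<leadsto> \<Delta>) \<longleftrightarrow> cut_free_provable (\<Pi> @ \<Theta> @ A # \<Sigma> \<leadsto> \<Delta>)"
proof (induction \<Theta> arbitrary: \<Pi>)
  case (Cons B \<Theta>)
  from Cons[of "\<Pi> @ [B]"] show ?case by (simp add: exchange_left[of \<Pi> A B])
qed simp

lemma move_right:
  "cut_free_provable (\<Gamma> \<leadsto> \<Pi> @ A # \<Theta> @ \<Sigma>) \<longleftrightarrow> cut_free_provable (\<Gamma> \<leadsto> \<Pi> @ \<Theta> @ A # \<Sigma>)"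
proof (induction \<Theta> arbitrary: \<Pi>)
  case (Cons B \<Theta>)
  from Cons[of "\<Pi> @ [B]"] show ?case by (simp add: exchange_right[of \<Gamma> \<Pi> A B])
qed simp

lemma weaken_left: "cut_free_provable (\<Gamma> \<leadsto> \<Delta>) \<Longrightarrow> cut_free_provable (\<Gamma>' @ \<Gamma> \<leadsto> \<Delta>)"
  by (induction \<Gamma>') (auto intro: cut_free_provable_rule1[OF WL])

lemma weaken_right: "cut_free_provable (\<Gamma> \<leadsto> \<Delta>) \<Longrightarrow> cut_free_provable (\<Gamma> \<leadsto> \<Delta> @ \<Delta>')"
proof (induction \<Delta>' rule: rev_induct)
  case (snoc A \<Delta>')
  then show ?case using cut_free_provable_rule1[OF WR[of \<Gamma> "\<Delta> @ \<Delta>'" A]] by simp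
qed simp

text \<open>A block of formulas that all occur elsewhere on the same side can be contracted away: each
  one is brought, together with another occurrence of it, to the end where contraction acts.\<close>

lemma absorb_left:
  "cut_free_provable (\<Gamma>' @ \<Gamma> \<leadsto> \<Delta>) \<Longrightarrow> set \<Gamma> \<subseteq> set \<Gamma>' \<Longrightarrow> cut_free_provable (\<Gamma>' \<leadsto> \<Delta>)"
proof (induction \<Gamma>)
  case (Cons A \<Gamma>)
  obtain X Y where \<Gamma>': "\<Gamma>' = X @ A # Y"
    using Cons.prems(2) by (auto dest: split_list)
  have "cut_free_provable (A # X @ Y @ A # \<Gamma> \<leadsto> \<Delta>)"
    using Cons.prems(1) \<Gamma>' move_left[of "[]" A X] by simp
  then have "cut_free_provable (A # A # X @ Y @ \<Gamma> \<leadsto> \<Delta>)"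
    using move_left[of "[A]" A "X @ Y"] by simp
  then have "cut_free_provable (A # X @ Y @ \<Gamma> \<leadsto> \<Delta>)"
    by (rule cut_free_provable_rule1[OF CL])
  then have "cut_free_provable (\<Gamma>' @ \<Gamma> \<leadsto> \<Delta>)"
    using \<Gamma>' move_left[of "[]" A X] by simp
  then show ?case using Cons by simp
qed simp

lemma absorb_right:
  "cut_free_provable (\<Gamma> \<leadsto> \<Delta> @ \<Delta>') \<Longrightarrow> set \<Delta> \<subseteq> set \<Delta>' \<Longrightarrow> cut_free_provable (\<Gamma> \<leadsto> \<Delta>')"
proof (induction \<Delta> rule: rev_induct)
  case (snoc A \<Delta>)
  obtain X Y where \<Delta>': "\<Delta>' = X @ A # Y"
    using snoc.prems(2) by (auto dest: split_list)
  have "cut_free_provable (\<Gamma> \<leadsto> \<Delta> @ A # X @ Y @ [A])"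
    using snoc.prems(1) \<Delta>' move_right[of \<Gamma> "\<Delta> @ A # X" A Y "[]"] by simp
  then have "cut_free_provable (\<Gamma> \<leadsto> (\<Delta> @ X @ Y) @ [A, A])"
    using move_right[of \<Gamma> \<Delta> A "X @ Y" "[A]"] by simp
  then have "cut_free_provable (\<Gamma> \<leadsto> (\<Delta> @ X @ Y) @ [A])"
    by (rule cut_free_provable_rule1[OF CR])
  then have "cut_free_provable (\<Gamma> \<leadsto> \<Delta> @ \<Delta>')"
    using \<Delta>' move_right[of \<Gamma> "\<Delta> @ X" A Y "[]"] by simp
  then show ?case using snoc by simp
qed simp

text \<open>Weaken by the target lists, then absorb the original ones.\<close>

lemma cut_free_provable_mono:
  assumes "cut_free_provable (\<Gamma> \<leadsto> \<Delta>)" "set \<Gamma> \<subseteq> set \<Gamma>'" "set \<Delta> \<subseteq> set \<Delta>'"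
  shows "cut_free_provable (\<Gamma>' \<leadsto> \<Delta>')"
  using assms weaken_left absorb_left weaken_right absorb_right by meson

section \<open>Invertible forms of the lossy rules\<close>

text \<open>The second application of a left rule on conjunction needs \<open>B\<close> in front, hence the reordering
  between the two; the duplicate conjunction is then contracted.\<close>

lemma conj_left:
  assumes "cut_free_provable (A # B # \<Gamma> \<leadsto> \<Delta>)"
  shows "cut_free_provable ((A \<^bold>\<and> B) # \<Gamma> \<leadsto> \<Delta>)"
proof -
  have "cut_free_provable ((A \<^bold>\<and> B) # B # \<Gamma> \<leadsto> \<Delta>)"
    using assms by (rule cut_free_provable_rule1[OF ConjL1])
  then have "cut_free_provable (B # (A \<^bold>\<and> B) # \<Gamma> \<leadsto> \<Delta>)"
    by (rule cut_free_provable_mono) auto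
  then have "cut_free_provable ((A \<^bold>\<and> B) # (A \<^bold>\<and> B) # \<Gamma> \<leadsto> \<Delta>)"
    by (rule cut_free_provable_rule1[OF ConjL2])
  then show ?thesis by (rule cut_free_provable_mono) auto
qed

lemma disj_right:
  assumes "cut_free_provable (\<Gamma> \<leadsto> \<Delta> @ [A, B])"
  shows "cut_free_provable (\<Gamma> \<leadsto> \<Delta> @ [A \<^bold>\<or> B])"
proof -
  have "cut_free_provable (\<Gamma> \<leadsto> (\<Delta> @ [A]) @ [B])" using assms by simp
  then have "cut_free_provable (\<Gamma> \<leadsto> (\<Delta> @ [A]) @ [A \<^bold>\<or> B])"
    by (rule cut_free_provable_rule1[OF DisjR2])
  then have "cut_free_provable (\<Gamma> \<leadsto> (\<Delta> @ [A \<^bold>\<or> B]) @ [A])"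
    by (rule cut_free_provable_mono) auto
  then have "cut_free_provable (\<Gamma> \<leadsto> (\<Delta> @ [A \<^bold>\<or> B]) @ [A \<^bold>\<or> B])"
    by (rule cut_free_provable_rule1[OF DisjR1])
  then show ?thesis by (rule cut_free_provable_mono) auto
qed

section \<open>Cut-free completeness\<close>

lemma valid_atomic_cut_free_provable:
  assumes "valid (\<Gamma> \<leadsto> \<Delta>)" "set \<Gamma> \<subseteq> range Var" "set \<Delta> \<subseteq> range Var"
  shows "cut_free_provable (\<Gamma> \<leadsto> \<Delta>)"
proof -
  let ?v = "\<lambda>p. Var p \<in> set \<Gamma>"
  have "\<forall>A \<in> set \<Gamma>. holds ?v A" using assms(2) by auto
  then obtain B where "B \<in> set \<Delta>" "holds ?v B" using assms(1) by auto
  then obtain p where "Var p \<in> set \<Gamma>" "Var p \<in> set \<Delta>" using assms(3) by auto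
  then show ?thesis
    by (intro cut_free_provable_mono[OF cut_free_provable_axiom]) auto
qed

text \<open>Variables have weight \<open>0\<close> and a compound formula weighs more than its components together.\<close>

fun weight :: "sequent \<Rightarrow> nat" where
  "weight (\<Gamma> \<leadsto> \<Delta>) = sum_list (map size \<Gamma>) + sum_list (map size \<Delta>)"

lemma valid_cut_free_provable: "valid S \<Longrightarrow> cut_free_provable S"
proof (induction S rule: measure_induct_rule[of weight])
  case (less S)
  obtain \<Gamma> \<Delta> where S: "S = (\<Gamma> \<leadsto> \<Delta>)" by (cases S)
  consider F where "F \<in> set \<Gamma>" "F \<notin> range Var"
    | F where "F \<in> set \<Delta>" "F \<notin> range Var"
    | "set \<Gamma> \<subseteq> range Var" "set \<Delta> \<subseteq> range Var"
    by blast
  then show ?case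
  proof cases
    case (1 F)
    then obtain X Y where \<Gamma>: "\<Gamma> = X @ F # Y" by (auto dest: split_list)
    have "cut_free_provable (F # X @ Y \<leadsto> \<Delta>)"
    proof (cases F)
      case (Var p)
      then show ?thesis using 1 by auto
    next
      case (Neg A)
      have "cut_free_provable (X @ Y \<leadsto> \<Delta> @ [A])"
        using less.prems Neg by (intro less.IH) (auto simp: S \<Gamma> ball_Un bex_Un)
      then show ?thesis unfolding Neg by (rule cut_free_provable_rule1[OF NegL])
    next
      case (Conj A B)
      have "cut_free_provable (A # B # X @ Y \<leadsto> \<Delta>)"
        using less.prems Conj by (intro less.IH) (auto simp: S \<Gamma> ball_Un bex_Un)
      then show ?thesis unfolding Conj by (rule conj_left)
    next
      case (Disj A B)
      have "cut_free_provable (A # X @ Y \<leadsto> \<Delta>)" "cut_free_provable (B # X @ Y \<leadsto> \<Delta>)"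
        using less.prems Disj by (auto intro!: less.IH simp: S \<Gamma> ball_Un bex_Un)
      then show ?thesis unfolding Disj by (rule cut_free_provable_rule2[OF DisjL])
    next
      case (Impl A B)
      have "cut_free_provable (X @ Y \<leadsto> \<Delta> @ [A])" "cut_free_provable (B # X @ Y \<leadsto> \<Delta>)"
        using less.prems Impl by (auto intro!: less.IH simp: S \<Gamma> ball_Un bex_Un)
      then show ?thesis unfolding Impl by (rule cut_free_provable_rule2[OF ImplL])
    qed
    then show ?thesis unfolding S \<Gamma> by (rule cut_free_provable_mono) auto
  next
    case (2 F)
    then obtain X Y where \<Delta>: "\<Delta> = X @ F # Y" by (auto dest: split_list)
    have "cut_free_provable (\<Gamma> \<leadsto> (X @ Y) @ [F])"
    proof (cases F)
      case (Var p)
      then show ?thesis using 2 by auto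
    next
      case (Neg A)
      have "cut_free_provable (A # \<Gamma> \<leadsto> X @ Y)"
        using less.prems Neg by (intro less.IH) (auto simp: S \<Delta> ball_Un bex_Un)
      then show ?thesis unfolding Neg by (rule cut_free_provable_rule1[OF NegR])
    next
      case (Conj A B)
      have "cut_free_provable (\<Gamma> \<leadsto> (X @ Y) @ [A])" "cut_free_provable (\<Gamma> \<leadsto> (X @ Y) @ [B])"
        using less.prems Conj by (auto intro!: less.IH simp: S \<Delta> ball_Un bex_Un) blast+
      then show ?thesis unfolding Conj by (rule cut_free_provable_rule2[OF ConjR])
    next
      case (Disj A B)
      have "cut_free_provable (\<Gamma> \<leadsto> (X @ Y) @ [A, B])"
        using less.prems Disj by (intro less.IH) (auto simp: S \<Delta> ball_Un bex_Un)
      then show ?thesis unfolding Disj by (rule disj_right)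
    next
      case (Impl A B)
      have "cut_free_provable (A # \<Gamma> \<leadsto> (X @ Y) @ [B])"
        using less.prems Impl by (intro less.IH) (auto simp: S \<Delta> ball_Un bex_Un)
      then show ?thesis unfolding Impl by (rule cut_free_provable_rule1[OF ImplR])
    qed
    then show ?thesis unfolding S \<Delta> by (rule cut_free_provable_mono) auto
  next
    case 3
    then show ?thesis using less.prems valid_atomic_cut_free_provable unfolding S by blast
  qed
qed

theorem theorem2p13:
  fixes \<Gamma> \<Delta> :: "form list"
  assumes "PLK_provable (\<Gamma> \<leadsto> \<Delta>)"
  shows "\<exists>t. PLK_proof t (\<Gamma> \<leadsto> \<Delta>) \<and> cut_free t"
  using valid_cut_free_provable[OF provable_valid[OF assms]]
  unfolding cut_free_provable_def .

end
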